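(* Let $\mathcal U \subseteq \sigma\mathcal F$ be countable and assume Odd has a winning strategy in the game $\mathrm{BM}(\mathcal F, \mathcal U^{\hookleftarrow})$. Then $\mathcal F$ has the weak amalgamation property.
   Context: Fix a countable first-order signature. $\mathcal F$ is a class, closed under isomorphisms, of countable finitely generated structures in this signature. $X \leq Y$ means that $X$ is a substructure of $Y$. $\sigma\mathcal F$ is the class of all structures of the form $\bigcup_{n\in\omega} X_n$, where $X_0 \leq X_1 \leq X_2 \leq \cdots$ is a chain of structures from $\mathcal F$. The game $\mathrm{BM}(\mathcal F, \mathcal U^{\hookleftarrow})$: two players, Eve and Odd, alternately build a chain $A_0 \leq A_1 \leq A_2 \leq \cdots$ of structures from $\mathcal F$. Eve starts by choosing $A_0 \in \mathcal F$; Odd responds with $A_1 \in \mathcal F$, $A_1 \geq A_0$; Eve responds with $A_2 \in \mathcal F$, $A_2 \geq A_1$; and so on (Eve chooses $A_n$ for even $n$, Odd for odd $n$). Odd wins if $A_\infty = \bigcup_{n\in\omega} A_n$ embeds into some $U \in \mathcal U$; otherwise Eve wins. A strategy prescribes a player's move as a function of the finite sequence of previous moves; it is winning if the player wins every play in which it is followed. $\mathcal F$ has the weak amalgamation property (WAP) if for every $Z \in \mathcal F$ there is $Z' \in \mathcal F$ with $Z \leq Z'$ such that for all embeddings $f\colon Z' \to X$, $g\colon Z' \to Y$ with $X, Y \in \mathcal F$ there exist $V \in \mathcal F$ and embeddings $f'\colon X \to V$, $g'\colon Y \to V$ satisfying $f'\circ f \restriction Z = g' \circ g\restriction Z$. 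*)

theory Defs
  imports "HOL-Library.Countable_Set"
begin

(* A signature is single-sorted; constants are the function symbols of arity 0. *)
record ('f, 'r) signature =
  fun_syms :: "'f set"
  rel_syms :: "'r set"
  fun_arity :: "'f \<Rightarrow> nat"
  rel_arity :: "'r \<Rightarrow> nat"

definition countable_signature :: "('f, 'r) signature \<Rightarrow> bool" where
  "countable_signature \<Sigma> \<longleftrightarrow> countable (fun_syms \<Sigma>) \<and> countable (rel_syms \<Sigma>)"

record ('a, 'f, 'r) struct =
  universe :: "'a set"
  fun_in :: "'f \<Rightarrow> 'a list \<Rightarrow> 'a"
  rel_in :: "'r \<Rightarrow> 'a list set"

(* The argument tuples of length n over the set D. *)
definition tuples :: "'a set \<Rightarrow> nat \<Rightarrow> 'a list set" where
  "tuples D n = {xs. length xs = n \<and> set xs \<subseteq> D}"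

(* Interpretations are extensional (undefined, respectively empty, outside the signature and
   outside the universe), so that HOL equality of structures is equality of structures.
   The universe may be empty if the signature has no constants. *)
definition is_struct :: "('f, 'r) signature \<Rightarrow> ('a, 'f, 'r) struct \<Rightarrow> bool" where
  "is_struct \<Sigma> A \<longleftrightarrow>
     (\<forall>f\<in>fun_syms \<Sigma>. \<forall>xs\<in>tuples (universe A) (fun_arity \<Sigma> f). fun_in A f xs \<in> universe A) \<and>
     (\<forall>f xs. \<not> (f \<in> fun_syms \<Sigma> \<and> xs \<in> tuples (universe A) (fun_arity \<Sigma> f)) \<longrightarrow> fun_in A f xs = undefined) \<and>
     (\<forall>r\<in>rel_syms \<Sigma>. rel_in A r \<subseteq> tuples (universe A) (rel_arity \<Sigma> r)) \<and>
     (\<forall>r. r \<notin> rel_syms \<Sigma> \<longrightarrow> rel_in A r = {})"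

definition substruct :: "('f, 'r) signature \<Rightarrow> ('a, 'f, 'r) struct \<Rightarrow> ('a, 'f, 'r) struct \<Rightarrow> bool" where
  "substruct \<Sigma> A B \<longleftrightarrow>
     is_struct \<Sigma> A \<and> is_struct \<Sigma> B \<and> universe A \<subseteq> universe B \<and>
     (\<forall>f\<in>fun_syms \<Sigma>. \<forall>xs\<in>tuples (universe A) (fun_arity \<Sigma> f). fun_in A f xs = fun_in B f xs) \<and>
     (\<forall>r\<in>rel_syms \<Sigma>. \<forall>xs\<in>tuples (universe A) (rel_arity \<Sigma> r). xs \<in> rel_in A r \<longleftrightarrow> xs \<in> rel_in B r)"

definition embedding ::
  "('f, 'r) signature \<Rightarrow> ('a, 'f, 'r) struct \<Rightarrow> ('b, 'f, 'r) struct \<Rightarrow> ('a \<Rightarrow> 'b) \<Rightarrow> bool" where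
  "embedding \<Sigma> A B h \<longleftrightarrow>
     is_struct \<Sigma> A \<and> is_struct \<Sigma> B \<and> h ` universe A \<subseteq> universe B \<and> inj_on h (universe A) \<and>
     (\<forall>f\<in>fun_syms \<Sigma>. \<forall>xs\<in>tuples (universe A) (fun_arity \<Sigma> f). h (fun_in A f xs) = fun_in B f (map h xs)) \<and>
     (\<forall>r\<in>rel_syms \<Sigma>. \<forall>xs\<in>tuples (universe A) (rel_arity \<Sigma> r). xs \<in> rel_in A r \<longleftrightarrow> map h xs \<in> rel_in B r)"

definition embeds :: "('f, 'r) signature \<Rightarrow> ('a, 'f, 'r) struct \<Rightarrow> ('b, 'f, 'r) struct \<Rightarrow> bool" where
  "embeds \<Sigma> A B \<longleftrightarrow> (\<exists>h. embedding \<Sigma> A B h)"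

definition isomorphic :: "('f, 'r) signature \<Rightarrow> ('a, 'f, 'r) struct \<Rightarrow> ('b, 'f, 'r) struct \<Rightarrow> bool" where
  "isomorphic \<Sigma> A B \<longleftrightarrow> (\<exists>h. embedding \<Sigma> A B h \<and> h ` universe A = universe B)"

inductive_set generated :: "('f, 'r) signature \<Rightarrow> ('a, 'f, 'r) struct \<Rightarrow> 'a set \<Rightarrow> 'a set"
  for \<Sigma> A S where
  base: "x \<in> S \<Longrightarrow> x \<in> generated \<Sigma> A S"
| app: "\<lbrakk>f \<in> fun_syms \<Sigma>; length xs = fun_arity \<Sigma> f; \<forall>x\<in>set xs. x \<in> generated \<Sigma> A S\<rbrakk>
    \<Longrightarrow> fun_in A f xs \<in> generated \<Sigma> A S"

definition finitely_generated :: "('f, 'r) signature \<Rightarrow> ('a, 'f, 'r) struct \<Rightarrow> bool" where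
  "finitely_generated \<Sigma> A \<longleftrightarrow> (\<exists>S. finite S \<and> S \<subseteq> universe A \<and> generated \<Sigma> A S = universe A)"

(* Classes of structures are sets of structures whose universes are subsets of one type 'a.
   When 'a is uncountable this loses nothing: every countable structure has an isomorphic copy
   over 'a, and any embedding of A into a countable structure B over 'a can be turned, by
   replacing B with an isomorphic copy over 'a, into an inclusion A \<le> B. *)
definition fg_class :: "('f, 'r) signature \<Rightarrow> ('a, 'f, 'r) struct set \<Rightarrow> bool" where
  "fg_class \<Sigma> F \<longleftrightarrow>
     (\<forall>A\<in>F. is_struct \<Sigma> A \<and> countable (universe A) \<and> finitely_generated \<Sigma> A)"

definition iso_closed :: "('f, 'r) signature \<Rightarrow> ('a, 'f, 'r) struct set \<Rightarrow> bool" where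
  "iso_closed \<Sigma> F \<longleftrightarrow> (\<forall>A\<in>F. \<forall>B. isomorphic \<Sigma> A B \<longrightarrow> B \<in> F)"

definition chain_in ::
  "('f, 'r) signature \<Rightarrow> ('a, 'f, 'r) struct set \<Rightarrow> (nat \<Rightarrow> ('a, 'f, 'r) struct) \<Rightarrow> bool" where
  "chain_in \<Sigma> F X \<longleftrightarrow> (\<forall>n. X n \<in> F \<and> substruct \<Sigma> (X n) (X (Suc n)))"

(* A tuple over the union of a chain already lies in some stage, and all stages containing it
   agree on the value of a function at it, so the first such stage may be used. *)
definition chain_union :: "(nat \<Rightarrow> ('a, 'f, 'r) struct) \<Rightarrow> ('a, 'f, 'r) struct" where
  "chain_union X =
     \<lparr> universe = (\<Union>n. universe (X n)),
       fun_in = (\<lambda>f xs. if \<exists>n. set xs \<subseteq> universe (X n)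
                         then fun_in (X (LEAST n. set xs \<subseteq> universe (X n))) f xs else undefined),
       rel_in = (\<lambda>r. \<Union>n. rel_in (X n) r) \<rparr>"

definition sigma_class :: "('f, 'r) signature \<Rightarrow> ('a, 'f, 'r) struct set \<Rightarrow> ('a, 'f, 'r) struct set" where
  "sigma_class \<Sigma> F = {chain_union X | X. chain_in \<Sigma> F X}"

(* A finite sequence of moves; the move number n (counted from 0) belongs to Eve if n is even
   and to Odd if n is odd, so Odd is to move exactly when an odd number of moves was made. *)
definition position :: "('f, 'r) signature \<Rightarrow> ('a, 'f, 'r) struct set \<Rightarrow> ('a, 'f, 'r) struct list \<Rightarrow> bool" where
  "position \<Sigma> F p \<longleftrightarrow>
     set p \<subseteq> F \<and> (\<forall>n. Suc n < length p \<longrightarrow> substruct \<Sigma> (p ! n) (p ! Suc n))"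

definition odd_strategy ::
  "('f, 'r) signature \<Rightarrow> ('a, 'f, 'r) struct set \<Rightarrow> (('a, 'f, 'r) struct list \<Rightarrow> ('a, 'f, 'r) struct) \<Rightarrow> bool" where
  "odd_strategy \<Sigma> F s \<longleftrightarrow>
     (\<forall>p. position \<Sigma> F p \<and> odd (length p) \<longrightarrow> s p \<in> F \<and> substruct \<Sigma> (last p) (s p))"

definition odd_follows ::
  "(('a, 'f, 'r) struct list \<Rightarrow> ('a, 'f, 'r) struct) \<Rightarrow> (nat \<Rightarrow> ('a, 'f, 'r) struct) \<Rightarrow> bool" where
  "odd_follows s A \<longleftrightarrow> (\<forall>n. odd n \<longrightarrow> A n = s (map A [0..<n]))"

definition odd_wins ::
  "('f, 'r) signature \<Rightarrow> ('a, 'f, 'r) struct set \<Rightarrow> (nat \<Rightarrow> ('a, 'f, 'r) struct) \<Rightarrow> bool" where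
  "odd_wins \<Sigma> \<U> A \<longleftrightarrow> (\<exists>U\<in>\<U>. embeds \<Sigma> (chain_union A) U)"

definition odd_has_winning_strategy ::
  "('f, 'r) signature \<Rightarrow> ('a, 'f, 'r) struct set \<Rightarrow> ('a, 'f, 'r) struct set \<Rightarrow> bool" where
  "odd_has_winning_strategy \<Sigma> F \<U> \<longleftrightarrow>
     (\<exists>s. odd_strategy \<Sigma> F s \<and>
        (\<forall>A. chain_in \<Sigma> F A \<and> odd_follows s A \<longrightarrow> odd_wins \<Sigma> \<U> A))"

definition WAP :: "('f, 'r) signature \<Rightarrow> ('a, 'f, 'r) struct set \<Rightarrow> bool" where
  "WAP \<Sigma> F \<longleftrightarrow>
     (\<forall>Z\<in>F. \<exists>Z'\<in>F. substruct \<Sigma> Z Z' \<and>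
        (\<forall>X\<in>F. \<forall>Y\<in>F. \<forall>f g. embedding \<Sigma> Z' X f \<and> embedding \<Sigma> Z' Y g \<longrightarrow>
           (\<exists>V\<in>F. \<exists>f' g'. embedding \<Sigma> X V f' \<and> embedding \<Sigma> Y V g' \<and>
              (\<forall>z\<in>universe Z. f' (f z) = g' (g z)))))"

end

(* Suppose weak amalgamation fails at Z, and fix a finite tuple of generators of Z. Eve opens
   with Z. There are only countably many pairs of some U in the countable family and a tuple of U
   that could be the image of the generators; Eve handles one of them in each round. If both
   members of a pair of extensions of the current structure witnessing the failure of WAP embedded
   into U with the prescribed images of the generators, then by finite generation both would embed
   into one stage of U, amalgamating the pair over Z. So Eve can play a member that does not, and
   in the end the union of the play embeds into no U. *)

theory Submission
  imports Defs
begin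

section \<open>Embeddings and substructures\<close>

lemma map_in_tuples: "xs \<in> tuples D n \<Longrightarrow> h ` D \<subseteq> E \<Longrightarrow> map h xs \<in> tuples E n"
  by (auto simp: tuples_def)

lemma tuples_mono: "xs \<in> tuples D n \<Longrightarrow> D \<subseteq> E \<Longrightarrow> xs \<in> tuples E n"
  by (auto simp: tuples_def)

lemma embedding_fun_in:
  "embedding \<Sigma> A B h \<Longrightarrow> f \<in> fun_syms \<Sigma> \<Longrightarrow> xs \<in> tuples (universe A) (fun_arity \<Sigma> f) \<Longrightarrow>
    h (fun_in A f xs) = fun_in B f (map h xs)"
  by (auto simp: embedding_def)

lemma embedding_rel_in:
  "embedding \<Sigma> A B h \<Longrightarrow> r \<in> rel_syms \<Sigma> \<Longrightarrow> xs \<in> tuples (universe A) (rel_arity \<Sigma> r) \<Longrightarrow>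
    xs \<in> rel_in A r \<longleftrightarrow> map h xs \<in> rel_in B r"
  by (auto simp: embedding_def)

lemma is_struct_closed:
  "is_struct \<Sigma> A \<Longrightarrow> f \<in> fun_syms \<Sigma> \<Longrightarrow> xs \<in> tuples (universe A) (fun_arity \<Sigma> f) \<Longrightarrow>
    fun_in A f xs \<in> universe A"
  by (auto simp: is_struct_def)

lemma embedding_comp:
  assumes g: "embedding \<Sigma> A B g" and h: "embedding \<Sigma> B C h"
  shows "embedding \<Sigma> A C (h \<circ> g)"
proof -
  have gB: "g ` universe A \<subseteq> universe B" and hC: "h ` universe B \<subseteq> universe C"
    using g h by (auto simp: embedding_def)
  show ?thesis
    unfolding embedding_def
  proof (intro conjI ballI)
    show "is_struct \<Sigma> A" "is_struct \<Sigma> C" using g h by (auto simp: embedding_def)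
    show "(h \<circ> g) ` universe A \<subseteq> universe C" using gB hC by auto
    show "inj_on (h \<circ> g) (universe A)"
      using g h gB by (auto simp: embedding_def intro: comp_inj_on inj_on_subset)
  next
    fix f xs assume "f \<in> fun_syms \<Sigma>" and "xs \<in> tuples (universe A) (fun_arity \<Sigma> f)"
    then show "(h \<circ> g) (fun_in A f xs) = fun_in C f (map (h \<circ> g) xs)"
      by (simp add: embedding_fun_in[OF g] embedding_fun_in[OF h] map_in_tuples[OF _ gB])
  next
    fix r xs assume "r \<in> rel_syms \<Sigma>" and "xs \<in> tuples (universe A) (rel_arity \<Sigma> r)"
    then show "xs \<in> rel_in A r \<longleftrightarrow> map (h \<circ> g) xs \<in> rel_in C r"
      by (simp add: embedding_rel_in[OF g] embedding_rel_in[OF h] map_in_tuples[OF _ gB])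
  qed
qed

text \<open>Reduces transitivity of \<open>substruct\<close> and restriction of embeddings to
  composition of embeddings.\<close>

lemma substruct_iff_embedding_id: "substruct \<Sigma> A B \<longleftrightarrow> embedding \<Sigma> A B id"
  by (auto simp: substruct_def embedding_def)

text \<open>Maps are total HOL functions, so an embedding has arbitrary values off the universe of
  \<open>A\<close>; this allows them to be ignored.\<close>

lemma embedding_cong:
  assumes "embedding \<Sigma> A B g" and eq: "\<And>x. x \<in> universe A \<Longrightarrow> g x = h x"
  shows "embedding \<Sigma> A B h"
proof -
  have map_eq: "map h xs = map g xs" if "xs \<in> tuples (universe A) n" for xs n
    using that eq by (auto simp: tuples_def)
  show ?thesis
    using assms(1) is_struct_closed[of \<Sigma> A] inj_on_cong[of "universe A" g h]
    by (simp add: embedding_def map_eq eq[symmetric])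
qed

lemma substruct_refl: "is_struct \<Sigma> A \<Longrightarrow> substruct \<Sigma> A A"
  by (simp add: substruct_def)

lemma substruct_trans: "substruct \<Sigma> A B \<Longrightarrow> substruct \<Sigma> B C \<Longrightarrow> substruct \<Sigma> A C"
  unfolding substruct_iff_embedding_id using embedding_comp[of \<Sigma> A B id C id] by simp

lemma embedding_restrict: "substruct \<Sigma> A B \<Longrightarrow> embedding \<Sigma> B C h \<Longrightarrow> embedding \<Sigma> A C h"
  unfolding substruct_iff_embedding_id using embedding_comp[of \<Sigma> A B id C h] by simp

lemma embedding_corestrict:
  assumes h: "embedding \<Sigma> A C h" and B: "substruct \<Sigma> B C" and im: "h ` universe A \<subseteq> universe B"
  shows "embedding \<Sigma> A B h"
  using assms map_in_tuples[OF _ im] by (simp add: embedding_def substruct_def)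

section \<open>Embeddings and generating sets\<close>

lemma generated_subset:
  assumes "is_struct \<Sigma> A" and "S \<subseteq> universe A" and "x \<in> generated \<Sigma> A S"
  shows "x \<in> universe A"
  using assms(3)
proof induction
  case (base x)
  then show ?case using assms(2) by auto
next
  case (app f xs)
  then show ?case by (intro is_struct_closed[OF assms(1)]) (auto simp: tuples_def)
qed

text \<open>The elements on which two embeddings agree are closed under the functions of
  \<open>A\<close>.\<close>

lemma embedding_eq_on_generated:
  assumes g: "embedding \<Sigma> A B g" and h: "embedding \<Sigma> A B h"
    and S: "S \<subseteq> universe A" and eq: "\<And>x. x \<in> S \<Longrightarrow> g x = h x" and x: "x \<in> generated \<Sigma> A S"
  shows "g x = h x"
  using x
proof induction
  case (base x)
  then show ?case by (rule eq)
next
  case (app f xs)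
  have A: "is_struct \<Sigma> A" using g by (simp add: embedding_def)
  have xs: "xs \<in> tuples (universe A) (fun_arity \<Sigma> f)"
    using app generated_subset[OF A S] by (auto simp: tuples_def)
  have "map g xs = map h xs" using app by auto
  then show ?case unfolding embedding_fun_in[OF g app(1) xs] embedding_fun_in[OF h app(1) xs]
    by (rule arg_cong)
qed

text \<open>The preimage of a substructure is closed under the functions of \<open>A\<close>, so it
  suffices to locate the images of generators.\<close>

lemma embedding_image_generated:
  assumes h: "embedding \<Sigma> A C h" and B: "substruct \<Sigma> B C"
    and S: "S \<subseteq> universe A" and im: "h ` S \<subseteq> universe B" and x: "x \<in> generated \<Sigma> A S"
  shows "h x \<in> universe B"
  using x
proof induction
  case (base x)
  then show ?case using im by auto
next
  case (app f xs)
  have A: "is_struct \<Sigma> A" using h by (simp add: embedding_def)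
  have "xs \<in> tuples (universe A) (fun_arity \<Sigma> f)"
    using app generated_subset[OF A S] by (auto simp: tuples_def)
  moreover have "map h xs \<in> tuples (universe B) (fun_arity \<Sigma> f)"
    using app by (auto simp: tuples_def)
  ultimately show ?case
    using B app(1) is_struct_closed[of \<Sigma> B f "map h xs"]
    by (simp add: embedding_fun_in[OF h] substruct_def)
qed

section \<open>Isomorphic copies\<close>

lemma transport_structure:
  fixes A :: "('a, 'f, 'r) struct" and i :: "'a \<Rightarrow> 'b"
  assumes A: "is_struct \<Sigma> A" and inj: "inj_on i (universe A)"
  obtains B where "universe B = i ` universe A" and "embedding \<Sigma> A B i"
proof -
  define j where "j = inv_into (universe A) i"
  \<comment> \<open>Functions are pulled back along \<open>j\<close>, with the default
    \<open>undefined\<close> that extensionality demands; relations outside the signature stay empty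
    because they are empty in \<open>A\<close>.\<close>
  define B where "B = \<lparr>universe = i ` universe A,
    fun_in = (\<lambda>f xs. if f \<in> fun_syms \<Sigma> \<and> xs \<in> tuples (i ` universe A) (fun_arity \<Sigma> f)
      then i (fun_in A f (map j xs)) else undefined),
    rel_in = (\<lambda>r. map i ` rel_in A r)\<rparr>"
  have ji: "j (i x) = x" if "x \<in> universe A" for x
    using that inj by (simp add: j_def)
  have jA: "j ` i ` universe A \<subseteq> universe A" by (auto simp: ji)
  have ji_map: "map j (map i xs) = xs" if "xs \<in> tuples (universe A) n" for xs n
    using that ji by (auto simp: tuples_def intro!: map_idI)
  have rel: "rel_in A r \<subseteq> tuples (universe A) (rel_arity \<Sigma> r)" if "r \<in> rel_syms \<Sigma>" for r
    using A that by (auto simp: is_struct_def)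
  have "is_struct \<Sigma> B"
    unfolding is_struct_def
  proof (intro conjI ballI)
    fix f xs assume "f \<in> fun_syms \<Sigma>" and "xs \<in> tuples (universe B) (fun_arity \<Sigma> f)"
    then show "fun_in B f xs \<in> universe B"
      using is_struct_closed[OF A _ map_in_tuples[OF _ jA]] by (auto simp: B_def)
  next
    fix r assume "r \<in> rel_syms \<Sigma>"
    from rel[OF this] show "rel_in B r \<subseteq> tuples (universe B) (rel_arity \<Sigma> r)"
      by (auto simp: B_def intro: map_in_tuples)
  next
    show "\<forall>r. r \<notin> rel_syms \<Sigma> \<longrightarrow> rel_in B r = {}"
      using A by (auto simp: B_def is_struct_def)
  qed (auto simp: B_def)
  moreover have "xs \<in> rel_in A r \<longleftrightarrow> map i xs \<in> rel_in B r"
    if r: "r \<in> rel_syms \<Sigma>" and xs: "xs \<in> tuples (universe A) (rel_arity \<Sigma> r)" for r xs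
  proof
    assume "map i xs \<in> rel_in B r"
    then obtain ys where ys: "ys \<in> rel_in A r" and eq: "map i xs = map i ys"
      by (auto simp: B_def)
    then have "ys \<in> tuples (universe A) (rel_arity \<Sigma> r)" using rel[OF r] by auto
    \<comment> \<open>\<open>j\<close> recovers a tuple over \<open>A\<close> from its image, so
      \<open>i\<close> merges no related tuple with an unrelated one.\<close>
    with eq have "xs = ys" by (metis ji_map xs)
    with ys show "xs \<in> rel_in A r" by simp
  qed (auto simp: B_def)
  ultimately have "embedding \<Sigma> A B i"
    using A inj ji_map map_in_tuples[of _ "universe A" _ i "i ` universe A"]
    by (auto simp: embedding_def B_def simp del: map_map)
  then show thesis by (rule that[rotated]) (simp add: B_def)
qed

text \<open>An uncountable type has infinitely many points outside the countable set
  \<open>C\<close>, which leaves room for the part of \<open>D\<close> not in the image of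
  \<open>f\<close>.\<close>

lemma inverse_extends_to_injection:
  fixes f :: "'a \<Rightarrow> 'b"
  assumes unc: "uncountable (UNIV :: 'a set)" and "countable C" and "countable D"
    and f: "inj_on f C" "f ` C \<subseteq> D"
  obtains i :: "'b \<Rightarrow> 'a" where "inj_on i D" and "\<And>z. z \<in> C \<Longrightarrow> i (f z) = z"
proof -
  have "uncountable (- C)"
    using unc assms(2) by (metis Compl_eq_Diff_UNIV uncountable_minus_countable)
  then have "infinite (- C)" using countable_finite by blast
  then obtain e :: "nat \<Rightarrow> 'a" where e: "inj e" "range e \<subseteq> - C"
    using infinite_countable_subset by blast
  \<comment> \<open>The numbering of \<open>D\<close>, followed by \<open>e\<close>, sends the
    remaining points outside \<open>C\<close>, so they cannot collide with the values of the inverse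
    of \<open>f\<close>.\<close>
  define i where "i y = (if y \<in> f ` C then inv_into C f y else e (to_nat_on D y))" for y
  have eC: "e n \<notin> C" for n using e by auto
  have if_eq: "i (f z) = z" if "z \<in> C" for z using that f(1) by (simp add: i_def)
  have i_in: "i y \<in> C \<longleftrightarrow> y \<in> f ` C" for y
    using eC by (simp add: i_def inv_into_into)
  have "inj_on i D"
  proof (rule inj_onI)
    fix x y assume xy: "x \<in> D" "y \<in> D" "i x = i y"
    show "x = y"
    proof (cases "x \<in> f ` C")
      case True
      moreover have "y \<in> f ` C" using True i_in xy(3) by metis
      ultimately show ?thesis using if_eq xy(3) by auto
    next
      case False
      moreover have "y \<notin> f ` C" using False i_in xy(3) by metis
      ultimately have "to_nat_on D x = to_nat_on D y"
        using xy(3) e(1) by (simp add: i_def inj_eq)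
      then show ?thesis using xy(1,2) assms(3) by simp
    qed
  qed
  then show thesis using if_eq by (rule that)
qed

text \<open>Moves in the game are inclusions, whereas the failure of WAP yields embeddings. Renaming
  the points of \<open>B\<close> turns \<open>f\<close> into an inclusion.\<close>

lemma embedding_as_inclusion:
  fixes A :: "('a, 'f, 'r) struct" and B :: "('b, 'f, 'r) struct"
  assumes unc: "uncountable (UNIV :: 'a set)"
    and cnt: "countable (universe A)" "countable (universe B)"
    and f: "embedding \<Sigma> A B f"
  obtains C :: "('a, 'f, 'r) struct" and i
  where "embedding \<Sigma> B C i" and "i ` universe B = universe C" and "substruct \<Sigma> A C"
    and "\<And>z. z \<in> universe A \<Longrightarrow> i (f z) = z"
proof -
  have B: "is_struct \<Sigma> B" and "inj_on f (universe A)" "f ` universe A \<subseteq> universe B"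
    using f by (auto simp: embedding_def)
  then obtain i :: "'b \<Rightarrow> 'a" where inj: "inj_on i (universe B)"
    and i: "\<And>z. z \<in> universe A \<Longrightarrow> i (f z) = z"
    using inverse_extends_to_injection[OF unc cnt] by metis
  obtain C where C: "universe C = i ` universe B" "embedding \<Sigma> B C i"
    using transport_structure[OF B inj] by metis
  have "substruct \<Sigma> A C"
    \<comment> \<open>On the universe of \<open>A\<close> the composite of \<open>f\<close> and
      \<open>i\<close> is the identity.\<close>
    unfolding substruct_iff_embedding_id
    by (rule embedding_cong[OF embedding_comp[OF f C(2)]]) (simp add: i)
  with C i show thesis by (intro that) auto
qed

section \<open>Unions of chains\<close>

lemma chain_mono:
  assumes "chain_in \<Sigma> F X" and "m \<le> n"
  shows "substruct \<Sigma> (X m) (X n)"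
  using assms(2)
proof (induction rule: dec_induct)
  case base
  show ?case using assms(1) by (auto simp: chain_in_def substruct_def)
next
  case (step k)
  then show ?case using assms(1) substruct_trans unfolding chain_in_def by blast
qed

lemma universe_chain_union: "universe (chain_union X) = (\<Union>n. universe (X n))"
  by (simp add: chain_union_def)

lemma chain_union_finite_subset:
  assumes "chain_in \<Sigma> F X" and "finite S" and "S \<subseteq> universe (chain_union X)"
  shows "\<exists>n. S \<subseteq> universe (X n)"
  using assms(2,3)
proof induction
  case empty
  then show ?case by simp
next
  case (insert x S)
  then obtain m n where "S \<subseteq> universe (X m)" "x \<in> universe (X n)"
    by (auto simp: universe_chain_union)
  moreover have "universe (X m) \<subseteq> universe (X (max m n))" "universe (X n) \<subseteq> universe (X (max m n))"
    using chain_mono[OF assms(1)] by (simp_all add: substruct_def)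
  ultimately show ?case by (intro exI[of _ "max m n"]) auto
qed

text \<open>The least stage containing the tuple comes no later than stage \<open>n\<close>, hence
  is a substructure of it and gives the same value.\<close>

lemma fun_in_chain_union:
  assumes ch: "chain_in \<Sigma> F X" and f: "f \<in> fun_syms \<Sigma>"
    and xs: "xs \<in> tuples (universe (X n)) (fun_arity \<Sigma> f)"
  shows "fun_in (chain_union X) f xs = fun_in (X n) f xs"
proof -
  define m where "m = (LEAST n. set xs \<subseteq> universe (X n))"
  have n: "set xs \<subseteq> universe (X n)" using xs by (simp add: tuples_def)
  then have "m \<le> n" and m: "set xs \<subseteq> universe (X m)"
    unfolding m_def by (rule Least_le, rule LeastI)
  from \<open>m \<le> n\<close> have "substruct \<Sigma> (X m) (X n)" by (rule chain_mono[OF ch])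
  moreover have "xs \<in> tuples (universe (X m)) (fun_arity \<Sigma> f)"
    using m xs by (simp add: tuples_def)
  ultimately have "fun_in (X m) f xs = fun_in (X n) f xs"
    using f by (simp add: substruct_def)
  moreover have "fun_in (chain_union X) f xs = fun_in (X m) f xs"
    using n by (auto simp: chain_union_def m_def)
  ultimately show ?thesis by simp
qed

lemma rel_in_chain_union:
  assumes ch: "chain_in \<Sigma> F X" and r: "r \<in> rel_syms \<Sigma>"
    and xs: "xs \<in> tuples (universe (X n)) (rel_arity \<Sigma> r)"
  shows "xs \<in> rel_in (chain_union X) r \<longleftrightarrow> xs \<in> rel_in (X n) r"
proof
  assume "xs \<in> rel_in (chain_union X) r"
  then obtain m where m: "xs \<in> rel_in (X m) r" by (auto simp: chain_union_def)
  \<comment> \<open>The two stages are compared inside a common later one.\<close>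
  have sub: "substruct \<Sigma> (X m) (X (max m n))" "substruct \<Sigma> (X n) (X (max m n))"
    using chain_mono[OF ch] by simp_all
  have "xs \<in> tuples (universe (X m)) (rel_arity \<Sigma> r)"
    using m sub(1) r by (auto simp: substruct_def is_struct_def)
  with m xs r sub show "xs \<in> rel_in (X n) r" by (auto simp: substruct_def)
qed (auto simp: chain_union_def)

lemma is_struct_chain_union:
  assumes ch: "chain_in \<Sigma> F X"
  shows "is_struct \<Sigma> (chain_union X)"
  unfolding is_struct_def
proof (intro conjI ballI allI impI)
  have X: "is_struct \<Sigma> (X n)" for n using ch by (auto simp: chain_in_def substruct_def)
  {
    fix f xs assume f: "f \<in> fun_syms \<Sigma>"
      and xs: "xs \<in> tuples (universe (chain_union X)) (fun_arity \<Sigma> f)"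
    then obtain n where "xs \<in> tuples (universe (X n)) (fun_arity \<Sigma> f)"
      using chain_union_finite_subset[OF ch, of "set xs"] by (auto simp: tuples_def)
    then show "fun_in (chain_union X) f xs \<in> universe (chain_union X)"
      using is_struct_closed[OF X f] fun_in_chain_union[OF ch f]
      by (auto simp: universe_chain_union)
  next
    fix f xs
    assume "\<not> (f \<in> fun_syms \<Sigma> \<and> xs \<in> tuples (universe (chain_union X)) (fun_arity \<Sigma> f))"
    \<comment> \<open>A tuple that is no argument over the union is none over any stage, so
      whichever stage the \<open>LEAST\<close> selects already returns
      \<open>undefined\<close>.\<close>
    then have "\<not> (f \<in> fun_syms \<Sigma> \<and> xs \<in> tuples (universe (X n)) (fun_arity \<Sigma> f))" for n
      by (auto simp: universe_chain_union dest: tuples_mono[OF _ UN_upper[of n UNIV]])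
    then have "fun_in (X n) f xs = undefined" for n
      using X[of n] unfolding is_struct_def by blast
    then show "fun_in (chain_union X) f xs = undefined" by (simp add: chain_union_def)
  next
    fix r assume "r \<in> rel_syms \<Sigma>"
    then have "rel_in (X n) r \<subseteq> tuples (universe (X n)) (rel_arity \<Sigma> r)" for n
      using X[of n] by (simp add: is_struct_def)
    then show "rel_in (chain_union X) r \<subseteq> tuples (universe (chain_union X)) (rel_arity \<Sigma> r)"
      by (fastforce simp: chain_union_def tuples_def)
  next
    fix r assume "r \<notin> rel_syms \<Sigma>"
    then show "rel_in (chain_union X) r = {}"
      using X by (simp add: chain_union_def is_struct_def)
  }
qed

lemma substruct_chain_union:
  assumes ch: "chain_in \<Sigma> F X"
  shows "substruct \<Sigma> (X n) (chain_union X)"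
  using is_struct_chain_union[OF ch] chain_mono[OF ch, of n n]
    fun_in_chain_union[OF ch] rel_in_chain_union[OF ch]
  by (auto simp: substruct_def universe_chain_union)

text \<open>The finitely many images of generators lie in one stage, and the rest of the image
  follows them. The claim covers all later stages so that two structures can be sent into the same
  one.\<close>

lemma embedding_into_chain_stage:
  assumes ch: "chain_in \<Sigma> F X" and "finitely_generated \<Sigma> W"
    and h: "embedding \<Sigma> W (chain_union X) h"
  shows "\<exists>n. \<forall>m\<ge>n. embedding \<Sigma> W (X m) h"
proof -
  obtain S where S: "finite S" "S \<subseteq> universe W" "generated \<Sigma> W S = universe W"
    using assms(2) by (auto simp: finitely_generated_def)
  have "h ` S \<subseteq> universe (chain_union X)" using h S(2) by (auto simp: embedding_def)
  then obtain n where n: "h ` S \<subseteq> universe (X n)"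
    using chain_union_finite_subset[OF ch] S(1) by blast
  have "embedding \<Sigma> W (X m) h" if "n \<le> m" for m
  proof (rule embedding_corestrict[OF h substruct_chain_union[OF ch]])
    have "h ` S \<subseteq> universe (X m)"
      using n chain_mono[OF ch that] by (auto simp: substruct_def)
    then show "h ` universe W \<subseteq> universe (X m)"
      using embedding_image_generated[OF h substruct_chain_union[OF ch] S(2)] S(3) by auto
  qed
  then show ?thesis by blast
qed

section \<open>Plays\<close>

lemma position_snoc:
  assumes "position \<Sigma> F p" and "x \<in> F" and "p \<noteq> [] \<Longrightarrow> substruct \<Sigma> (last p) x"
  shows "position \<Sigma> F (p @ [x])"
  unfolding position_def
proof (intro conjI allI impI)
  show "set (p @ [x]) \<subseteq> F" using assms(1,2) by (auto simp: position_def)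
next
  fix n assume n: "Suc n < length (p @ [x])"
  show "substruct \<Sigma> ((p @ [x]) ! n) ((p @ [x]) ! Suc n)"
  proof (cases "Suc n < length p")
    case True
    then show ?thesis using assms(1) by (simp add: position_def nth_append)
  next
    case False
    with n have "length p = Suc n" by simp
    then show ?thesis using assms(3) by (cases p rule: rev_cases) (auto simp: nth_append)
  qed
qed

text \<open>\<open>E n W\<close> is Eve's reply to \<open>W\<close> after her opening
  \<open>Z\<close>, with \<open>n\<close> counting these replies from 0; Odd answers by
  \<open>s\<close>.\<close>

lemma play_exists:
  assumes s: "odd_strategy \<Sigma> F s" and Z: "Z \<in> F" "is_struct \<Sigma> Z"
    and E: "\<And>n W. W \<in> F \<Longrightarrow> substruct \<Sigma> Z W \<Longrightarrow> E n W \<in> F \<and> substruct \<Sigma> W (E n W)"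
  obtains A where "chain_in \<Sigma> F A" and "odd_follows s A" and "A 0 = Z"
    and "\<And>n. A (2 * n + 2) = E n (A (2 * n + 1))"
proof -
  \<comment> \<open>The recursion runs over whole histories because \<open>s\<close> reads all
    previous moves. Before move \<open>2 * n + 2\<close> the history has that same length, so
    halving after subtracting 2 returns the round \<open>n\<close>.\<close>
  define move where "move p = (if odd (length p) then s p else if p = [] then Z
    else E ((length p - 2) div 2) (last p))" for p
  define q where "q n = rec_nat [] (\<lambda>_ p. p @ [move p]) n" for n
  define A where "A n = move (q n)" for n
  have q0: "q 0 = []" and qS: "q (Suc n) = q n @ [A n]" for n
    by (simp_all add: q_def A_def)
  have q: "q n = map A [0..<n]" for n by (induction n) (simp_all add: q0 qS)
  have A_eq: "A n = move (map A [0..<n])" for n using A_def[of n] by (simp add: q)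
  have A0: "A 0 = Z" by (simp add: A_eq[of 0] move_def)
  have last: "last (map A [0..<Suc n]) = A n" for n by simp
  have even: "A (2 * n + 2) = E n (A (2 * n + 1))" for n
    by (subst A_eq) (simp add: move_def last)
  have odd: "A n = s (map A [0..<n])" if "odd n" for n
    using that by (subst A_eq) (simp add: move_def)
  \<comment> \<open>Legality of the history is what makes \<open>s\<close> answer legally; lying
    above \<open>Z\<close> is what makes \<open>E\<close> do so.\<close>
  have inv: "position \<Sigma> F (map A [0..<Suc n]) \<and> A n \<in> F \<and> substruct \<Sigma> Z (A n)
    \<and> (\<forall>m. n = Suc m \<longrightarrow> substruct \<Sigma> (A m) (A n))" for n
  proof (induction n)
    case 0
    show ?case using Z by (simp add: A0 position_def substruct_refl)
  next
    case (Suc n)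
    have step: "A (Suc n) \<in> F \<and> substruct \<Sigma> (A n) (A (Suc n))"
    proof (cases "odd (Suc n)")
      case True
      then have "s (map A [0..<Suc n]) \<in> F \<and>
          substruct \<Sigma> (last (map A [0..<Suc n])) (s (map A [0..<Suc n]))"
        using s Suc.IH unfolding odd_strategy_def by (metis length_map length_upt diff_zero)
      then show ?thesis unfolding odd[OF True] last .
    next
      case False
      then obtain k where "n = 2 * k + 1" by (auto elim: oddE)
      then show ?thesis using E[of "A n" k] Suc.IH even[of k] by simp
    qed
    moreover have "position \<Sigma> F (map A [0..<Suc n] @ [A (Suc n)])"
      by (rule position_snoc) (use Suc.IH step last in auto)
    ultimately show ?case using Suc.IH substruct_trans by auto
  qed
  have "chain_in \<Sigma> F A" using inv by (auto simp: chain_in_def)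
  moreover have "odd_follows s A" using odd by (simp add: odd_follows_def)
  ultimately show thesis using A0 even by (rule that)
qed

section \<open>Escaping a prescribed embedding\<close>

text \<open>The candidates for \<open>W\<close> are copies of \<open>X\<close> and \<open>Y\<close>
  containing \<open>Z'\<close>. If neither escaped, a stage of a chain with union \<open>U\<close>
  would amalgamate them; a stage is taken because \<open>V\<close> must belong to
  \<open>F\<close>.\<close>

lemma evasive_extension:
  fixes F :: "('a, 'f, 'r) struct set"
  assumes unc: "uncountable (UNIV :: 'a set)" and fg: "fg_class \<Sigma> F" and iso: "iso_closed \<Sigma> F"
    and U: "U \<in> sigma_class \<Sigma> F"
    and zs: "set zs \<subseteq> universe Z" "generated \<Sigma> Z (set zs) = universe Z"
    and Z': "Z' \<in> F" "substruct \<Sigma> Z Z'"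
    and XY: "X \<in> F" "Y \<in> F" "embedding \<Sigma> Z' X f" "embedding \<Sigma> Z' Y g"
    and no_amalgam: "\<not> (\<exists>V\<in>F. \<exists>f' g'. embedding \<Sigma> X V f' \<and> embedding \<Sigma> Y V g' \<and>
      (\<forall>z\<in>universe Z. f' (f z) = g' (g z)))"
  shows "\<exists>W\<in>F. substruct \<Sigma> Z' W \<and> \<not> (\<exists>h. embedding \<Sigma> W U h \<and> map h zs = us)"
proof (rule ccontr)
  assume contr: "\<not> ?thesis"
  have cnt: "countable (universe W)" "finitely_generated \<Sigma> W" if "W \<in> F" for W
    using that fg by (auto simp: fg_class_def)
  have ZZ': "universe Z \<subseteq> universe Z'" using Z'(2) by (simp add: substruct_def)
  obtain C where C: "chain_in \<Sigma> F C" "U = chain_union C" using U by (auto simp: sigma_class_def)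
  \<comment> \<open>Stated for an arbitrary extension \<open>e\<close> of \<open>Z'\<close>, to be
    used for both \<open>f\<close> and \<open>g\<close>.\<close>
  have ext: "\<exists>k. embedding \<Sigma> Z' U (k \<circ> e) \<and> map (k \<circ> e) zs = us \<and>
      (\<exists>n. \<forall>m\<ge>n. embedding \<Sigma> X (C m) k)"
    if X: "X \<in> F" and e: "embedding \<Sigma> Z' X e" for X e
  proof -
    obtain X0 i where i: "embedding \<Sigma> X X0 i" "i ` universe X = universe X0"
      and X0: "substruct \<Sigma> Z' X0" and ie: "\<And>z. z \<in> universe Z' \<Longrightarrow> i (e z) = z"
      using embedding_as_inclusion[OF unc cnt(1)[OF Z'(1)] cnt(1)[OF X] e] by metis
    \<comment> \<open>Closure under isomorphism makes the renamed copy a legal candidate, so by the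
      contrary assumption it does not escape.\<close>
    have "X0 \<in> F" using iso X i by (auto simp: iso_closed_def isomorphic_def)
    with X0 contr obtain h where h: "embedding \<Sigma> X0 U h" "map h zs = us" by blast
    have hi: "embedding \<Sigma> X U (h \<circ> i)" using i(1) h(1) by (rule embedding_comp)
    then have "embedding \<Sigma> Z' U (h \<circ> i \<circ> e)" using e embedding_comp by blast
    moreover have "map (h \<circ> i \<circ> e) zs = us" using h(2) zs(1) ZZ' ie by (auto simp: subset_iff)
    moreover have "\<exists>n. \<forall>m\<ge>n. embedding \<Sigma> X (C m) (h \<circ> i)"
      using embedding_into_chain_stage[OF C(1) cnt(2)[OF X]] hi C(2) by simp
    ultimately show ?thesis by blast
  qed
  from ext[OF XY(1,3)] ext[OF XY(2,4)] obtain k l m n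
    where k: "embedding \<Sigma> Z' U (k \<circ> f)" "map (k \<circ> f) zs = us" "\<forall>j\<ge>m. embedding \<Sigma> X (C j) k"
      and l: "embedding \<Sigma> Z' U (l \<circ> g)" "map (l \<circ> g) zs = us" "\<forall>j\<ge>n. embedding \<Sigma> Y (C j) l"
    by blast
  \<comment> \<open>Both composites send \<open>zs\<close> to \<open>us\<close>, and
    \<open>zs\<close> generates \<open>Z\<close> only; this is why the amalgamation obtained is over
    \<open>Z\<close> and not over all of \<open>Z'\<close>.\<close>
  have "(k \<circ> f) z = (l \<circ> g) z" if "z \<in> universe Z" for z
  proof (rule embedding_eq_on_generated[where S = "set zs" and g = "k \<circ> f" and h = "l \<circ> g" and x = z])
    show "embedding \<Sigma> Z U (k \<circ> f)" "embedding \<Sigma> Z U (l \<circ> g)"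
      using embedding_restrict[OF Z'(2)] k(1) l(1) by blast+
    show "(k \<circ> f) x = (l \<circ> g) x" if "x \<in> set zs" for x
      using that k(2) l(2) by (metis map_eq_conv)
  qed (use zs that in auto)
  moreover have "C (max m n) \<in> F" using C(1) by (simp add: chain_in_def)
  ultimately show False
    using no_amalgam k(3) l(3) by (metis comp_apply max.cobounded1 max.cobounded2)
qed

section \<open>Eve's play against a winning strategy of Odd\<close>

theorem theorem6p2:
  fixes \<Sigma> :: "('f, 'r) signature"
    and F \<U> :: "('a, 'f, 'r) struct set"
  assumes "uncountable (UNIV :: 'a set)"
    and "countable_signature \<Sigma>"
    and "fg_class \<Sigma> F"
    and "iso_closed \<Sigma> F"
    and "\<U> \<subseteq> sigma_class \<Sigma> F"
    and "countable \<U>"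
    and "odd_has_winning_strategy \<Sigma> F \<U>"
  shows "WAP \<Sigma> F"
proof (rule ccontr)
  assume not_WAP: "\<not> WAP \<Sigma> F"
  define amalgam where "amalgam Z X Y f g \<longleftrightarrow> (\<exists>V\<in>F. \<exists>f' g'. embedding \<Sigma> X V f' \<and>
      embedding \<Sigma> Y V g' \<and> (\<forall>z\<in>universe Z. f' (f z) = g' (g z)))"
    for Z X Y :: "('a, 'f, 'r) struct" and f g :: "'a \<Rightarrow> 'a"
  have "\<not> (\<forall>Z\<in>F. \<exists>Z'\<in>F. substruct \<Sigma> Z Z' \<and> (\<forall>X\<in>F. \<forall>Y\<in>F. \<forall>f g.
      embedding \<Sigma> Z' X f \<and> embedding \<Sigma> Z' Y g \<longrightarrow> amalgam Z X Y f g))"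
    using not_WAP unfolding WAP_def amalgam_def .
  then obtain Z where Z: "Z \<in> F" and bad: "\<And>Z'. Z' \<in> F \<Longrightarrow> substruct \<Sigma> Z Z' \<Longrightarrow>
      \<exists>X\<in>F. \<exists>Y\<in>F. \<exists>f g. embedding \<Sigma> Z' X f \<and> embedding \<Sigma> Z' Y g \<and> \<not> amalgam Z X Y f g"
    by meson
  obtain zs where zs: "set zs \<subseteq> universe Z" "generated \<Sigma> Z (set zs) = universe Z"
    using assms(3) Z unfolding fg_class_def finitely_generated_def by (metis finite_list)
  \<comment> \<open>Eve's tasks: a target \<open>U\<close> with a finite list of its points as
    possible image of \<open>zs\<close>.\<close>
  define D where "D = (SIGMA U:\<U>. lists (universe U))"
  have "countable (universe U)" if "U \<in> \<U>" for U
    using that assms(3,5) by (fastforce simp: sigma_class_def universe_chain_union chain_in_def fg_class_def)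
  then have D: "countable D" unfolding D_def using assms(6) by (intro countable_SIGMA) auto
  define evades where "evades d W \<longleftrightarrow> \<not> (\<exists>h. embedding \<Sigma> W (fst d) h \<and> map h zs = snd d)"
    for d :: "('a, 'f, 'r) struct \<times> 'a list" and W :: "('a, 'f, 'r) struct"
  \<comment> \<open>The condition \<open>d \<in> D\<close> makes the reply available for every
    \<open>d\<close>: if \<open>D\<close> is empty, its enumeration returns an arbitrary value, and
    Eve may then repeat the current structure.\<close>
  have "\<exists>W\<in>F. substruct \<Sigma> Z' W \<and> (d \<in> D \<longrightarrow> evades d W)"
    if Z': "Z' \<in> F" "substruct \<Sigma> Z Z'" for Z' d
  proof (cases "d \<in> D")
    case True
    then have "fst d \<in> sigma_class \<Sigma> F" using assms(5) by (auto simp: D_def)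
    moreover obtain X Y f g where XY: "X \<in> F" "Y \<in> F" "embedding \<Sigma> Z' X f" "embedding \<Sigma> Z' Y g"
      and "\<not> amalgam Z X Y f g"
      using bad[OF Z'] by blast
    ultimately show ?thesis
      using evasive_extension[OF assms(1,3,4) _ zs Z' XY, folded amalgam_def]
      unfolding evades_def by blast
  next
    case False
    then show ?thesis using Z' substruct_refl by (auto simp: substruct_def)
  qed
  then obtain E where E: "\<And>Z' d. Z' \<in> F \<Longrightarrow> substruct \<Sigma> Z Z' \<Longrightarrow>
      E Z' d \<in> F \<and> substruct \<Sigma> Z' (E Z' d) \<and> (d \<in> D \<longrightarrow> evades d (E Z' d))"
    by (metis (no_types, lifting))
  obtain s where s: "odd_strategy \<Sigma> F s"
    and wins: "\<And>A. chain_in \<Sigma> F A \<Longrightarrow> odd_follows s A \<Longrightarrow> odd_wins \<Sigma> \<U> A"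
    using assms(7) unfolding odd_has_winning_strategy_def by blast
  have "is_struct \<Sigma> Z" using assms(3) Z by (simp add: fg_class_def)
  \<comment> \<open>In round \<open>n\<close> Eve treats the task \<open>from_nat_into D n\<close>,
    after Odd's move \<open>2 * n + 1\<close>.\<close>
  then obtain A where A: "chain_in \<Sigma> F A" "odd_follows s A" "A 0 = Z"
    "\<And>n. A (2 * n + 2) = E (A (2 * n + 1)) (from_nat_into D n)"
    using play_exists[OF s Z, of "\<lambda>n W. E W (from_nat_into D n)"] E by metis
  obtain U h where U: "U \<in> \<U>" and h: "embedding \<Sigma> (chain_union A) U h"
    using wins[OF A(1,2)] by (auto simp: odd_wins_def embeds_def)
  have hA: "embedding \<Sigma> (A n) U h" for n
    using embedding_restrict[OF substruct_chain_union[OF A(1)] h] .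
  have "h ` universe Z \<subseteq> universe U" using hA[of 0] A(3) by (simp add: embedding_def)
  \<comment> \<open>Odd's winning embedding \<open>h\<close> itself determines a task. Its round
    \<open>n\<close> produced a stage evading it, yet \<open>h\<close> restricts to that
    stage.\<close>
  with U zs(1) have D_h: "(U, map h zs) \<in> D" by (auto simp: D_def image_subset_iff subset_iff)
  then obtain n where n: "from_nat_into D n = (U, map h zs)"
    using from_nat_into_surj[OF D] by blast
  have "A (2 * n + 1) \<in> F" "substruct \<Sigma> Z (A (2 * n + 1))"
    using A(1) chain_mono[OF A(1), of 0 "2 * n + 1"] A(3) by (simp_all add: chain_in_def)
  from E[OF this, of "(U, map h zs)"] hA[of "2 * n + 2"] A(4)[of n] n D_h
  show False by (auto simp: evades_def)
qed

end
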